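(* Let $A\in\mathbb{R}^{n\times n}$, $B\in\mathbb{R}^{n\times m}$ and consider the system $\Sigma: x^+=Ax+Bu$. Let $X=\mathrm{ch}(\{v_1,\dots,v_{n_x}\})=\{x\in\mathbb{R}^n\mid H_xx\le q\}$ and $U=\mathrm{ch}(\{w_0,\dots,w_{n_u}\})=\{u\in\mathbb{R}^m\mid H_uu\le q_u\}$ be closed convex polyhedral sets (for some matrices and vectors $H_x,q,H_u,q_u$ of appropriate dimensions), and let $N>n+1$ be an integer. Consider the optimization problem in the variables $x_0,\dots,x_N\in\mathbb{R}^n$, $u_0,\dots,u_{N-1}\in\mathbb{R}^m$, $\lambda_{ij}\in\mathbb{R}$ ($0\le i\le N-1$, $1\le j\le 2n$) and $d\in\mathbb{R}$: $$\begin{aligned}\min\quad&-d\\ \text{s.t.}\quad&x_{i+1}=Ax_i+Bu_i,\quad x_i\in X,\ u_i\in U,\quad i=0,\dots,N-1,\\&x_N+d\,s_j=\sum_{i=0}^{N-1}\lambda_{ij}x_i,\quad\sum_{i=0}^{N-1}\lambda_{ij}=1,\quad\lambda_{ij}\ge0,\quad j=1,\dots,2n,\ i=0,\dots,N-1,\\&d>0,\end{aligned}$$ where $s_j=(-1)^re_k$ for $j=rn+k$ with $1\le k\le n$, $r\in\{0,1\}$, and $e_k$ is the $k$-th standard basis vector of $\mathbb{R}^n$. This problem is feasible if and only if there exists a convex feasible trajectory (of horizon $N$) for $\Sigma$ under the constraints $(X,U)$.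
   Context: $\mathrm{ch}$ denotes convex hull; $\mathcal{B}_\epsilon(0)$ is the closed Euclidean ball of radius $\epsilon$ centred at $0$. Convex feasible trajectory of horizon $N$ for $\Sigma$ under $(X,U)$: states $x_0,\dots,x_{N-1}\in X$ and a state $x_N$, generated by $x_{t+1}=Ax_t+B\mathbf{u}(t)$, $0\le t\le N-1$, for some input trajectory $\mathbf{u}:\mathbb{N}_{\ge0}\to U$, such that for some $\epsilon>0$ one has $x_N+\mathcal{B}_\epsilon(0)\subseteq\mathrm{ch}(\{x_0,\dots,x_{N-1}\})$. (Equivalently, $x_0$ is open-loop convex feasible with respect to $(X,U)$, with horizon $N$.) Feasible (for the optimization problem) means that its constraint set is nonempty. *)

theory Defs
  imports "HOL-Analysis.Analysis"
begin

text \<open>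
  Finite sequences \<open>x\<^sub>0,\<dots>,x\<^sub>N\<close> are functions on \<^typ>\<open>nat\<close>; only the values at indices in the
  stated range are constrained, the remaining ones are arbitrary.
\<close>

definition convex_feasible_trajectory ::
  "real^'n^'n \<Rightarrow> real^'m^'n \<Rightarrow> (real^'n) set \<Rightarrow> (real^'m) set \<Rightarrow> nat \<Rightarrow> (nat \<Rightarrow> real^'n) \<Rightarrow> bool"
where
  "convex_feasible_trajectory A B X U N x \<longleftrightarrow>
     (\<forall>t<N. x t \<in> X) \<and>
     (\<exists>u :: nat \<Rightarrow> real^'m. (\<forall>t. u t \<in> U) \<and> (\<forall>t<N. x (t + 1) = A *v x t + B *v u t)) \<and>
     (\<exists>\<epsilon>>0. (\<lambda>y. x N + y) ` cball 0 \<epsilon> \<subseteq> convex hull (x ` {0..<N}))"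

text \<open>
  The index type \<open>'n\<close> carries no order, so the numbering of the coordinates by \<open>1,\<dots>,n\<close> is a
  parameter \<open>b\<close>, meant to be a bijection from \<open>{1..n}\<close> onto the index type: the \<open>k\<close>-th standard
  basis vector is \<open>axis (b k) 1\<close>. The decomposition \<open>j = r n + k\<close> with \<open>1 \<le> k \<le> n\<close> is
  \<open>r = (j - 1) div n\<close>, \<open>k = (j - 1) mod n + 1\<close>; see the lemma below.
\<close>

definition signed_basis :: "(nat \<Rightarrow> 'n) \<Rightarrow> nat \<Rightarrow> real^'n::finite" where
  "signed_basis b j =
     (-1) ^ ((j - 1) div CARD('n)) *\<^sub>R axis (b ((j - 1) mod CARD('n) + 1)) 1"

lemma signed_basis_eq:
  fixes b :: "nat \<Rightarrow> 'n::finite"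
  assumes "1 \<le> k" "k \<le> CARD('n)"
  shows "signed_basis b (r * CARD('n) + k) = (-1) ^ r *\<^sub>R axis (b k) 1"
proof -
  obtain l where k: "k = Suc l" "l < CARD('n)"
    using assms by (cases k) auto
  then show ?thesis
    by (simp add: signed_basis_def)
qed

text \<open>A minimisation problem: objective function and constraint set.\<close>

type_synonym 'v opt_problem = "('v \<Rightarrow> real) \<times> 'v set"

definition feasible_problem :: "'v opt_problem \<Rightarrow> bool" where
  "feasible_problem P \<longleftrightarrow> snd P \<noteq> {}"

text \<open>The decision variables are \<open>(x, u, \<lambda>, d)\<close>, with \<open>lam i j\<close> for \<open>\<lambda>\<^sub>i\<^sub>j\<close>.\<close>

definition trajectory_problem ::
  "real^'n^'n \<Rightarrow> real^'m^'n \<Rightarrow> (real^'n) set \<Rightarrow> (real^'m) set \<Rightarrow> nat \<Rightarrow> (nat \<Rightarrow> 'n) \<Rightarrow>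
   ((nat \<Rightarrow> real^'n) \<times> (nat \<Rightarrow> real^'m) \<times> (nat \<Rightarrow> nat \<Rightarrow> real) \<times> real) opt_problem"
where
  "trajectory_problem A B X U N b =
     (\<lambda>(x, u, lam, d). - d,
      {(x, u, lam, d).
         (\<forall>i\<in>{0..<N}. x (i + 1) = A *v x i + B *v u i \<and> x i \<in> X \<and> u i \<in> U) \<and>
         (\<forall>j\<in>{1..2 * CARD('n)}.
            x N + d *\<^sub>R signed_basis b j = (\<Sum>i\<in>{0..<N}. lam i j *\<^sub>R x i) \<and>
            (\<Sum>i\<in>{0..<N}. lam i j) = 1 \<and>
            (\<forall>i\<in>{0..<N}. 0 \<le> lam i j)) \<and>
         0 < d})"

end

theory Submission
  imports Defs
begin

text \<open>
  The constraints put the vertices \<open>x\<^sub>N \<plusminus> d e\<^sub>k\<close> of a cross-polytope into the convex hull of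
  \<open>x\<^sub>0,\<dots>,x\<^bsub>N-1\<^esub>\<close>. The cross-polytope contains the ball of radius \<open>d / n\<close> around \<open>x\<^sub>N\<close>, and
  conversely a ball of radius \<open>d\<close> contains these vertices.
\<close>

lemma convex_hull_finite_image_iff:
  fixes f :: "'a \<Rightarrow> 'b::real_vector"
  assumes "finite I"
  shows "y \<in> convex hull (f ` I) \<longleftrightarrow>
    (\<exists>c. (\<forall>i\<in>I. 0 \<le> c i) \<and> sum c I = 1 \<and> y = (\<Sum>i\<in>I. c i *\<^sub>R f i))"
proof
  define S where
    "S = {y. \<exists>c. (\<forall>i\<in>I. 0 \<le> c i) \<and> sum c I = 1 \<and> y = (\<Sum>i\<in>I. c i *\<^sub>R f i)}"
  have "f ` I \<subseteq> S"
  proof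
    fix z assume "z \<in> f ` I"
    then obtain k where k: "k \<in> I" "z = f k" by blast
    have "z = (\<Sum>i\<in>I. (if i = k then 1 else 0) *\<^sub>R f i)"
      using k assms by (simp add: if_distrib[of "\<lambda>t. t *\<^sub>R _"] cong: if_cong)
    then show "z \<in> S"
      unfolding S_def using k assms
      by (intro CollectI exI[of _ "\<lambda>i. if i = k then 1 else 0"]) simp
  qed
  moreover have "convex S"
  proof (rule convexI)
    fix y z :: 'b and s t :: real
    assume st: "0 \<le> s" "0 \<le> t" "s + t = 1" and "y \<in> S" "z \<in> S"
    then obtain c e where c: "\<forall>i\<in>I. 0 \<le> c i" "sum c I = 1" "y = (\<Sum>i\<in>I. c i *\<^sub>R f i)"
      and e: "\<forall>i\<in>I. 0 \<le> e i" "sum e I = 1" "z = (\<Sum>i\<in>I. e i *\<^sub>R f i)"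
      unfolding S_def by blast
    have "(\<Sum>i\<in>I. s * c i + t * e i) = 1"
      using st c e by (simp add: sum.distrib flip: sum_distrib_left)
    moreover have "s *\<^sub>R y + t *\<^sub>R z = (\<Sum>i\<in>I. (s * c i + t * e i) *\<^sub>R f i)"
      using c e by (simp add: scaleR_left_distrib sum.distrib scaleR_right.sum)
    ultimately show "s *\<^sub>R y + t *\<^sub>R z \<in> S"
      unfolding S_def using st c e
      by (intro CollectI exI[of _ "\<lambda>i. s * c i + t * e i"]) simp
  qed
  ultimately have "convex hull (f ` I) \<subseteq> S" by (rule hull_minimal)
  then show "\<exists>c. (\<forall>i\<in>I. 0 \<le> c i) \<and> sum c I = 1 \<and> y = (\<Sum>i\<in>I. c i *\<^sub>R f i)"
    if "y \<in> convex hull (f ` I)"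
    using that unfolding S_def by blast
next
  assume "\<exists>c. (\<forall>i\<in>I. 0 \<le> c i) \<and> sum c I = 1 \<and> y = (\<Sum>i\<in>I. c i *\<^sub>R f i)"
  then show "y \<in> convex hull (f ` I)"
    using assms by (auto intro!: convex_sum[OF _ convex_convex_hull] intro: hull_inc[OF imageI])
qed

lemma convex_contains_cball_of_axes:
  fixes z :: "real^'n" and C :: "(real^'n) set"
  assumes "convex C"
    and pos: "\<And>k. z + d *\<^sub>R axis k 1 \<in> C" and neg: "\<And>k. z - d *\<^sub>R axis k 1 \<in> C"
    and "0 < d"
  shows "(\<lambda>y. z + y) ` cball 0 (d / CARD('n)) \<subseteq> C"
proof
  fix p assume "p \<in> (\<lambda>y. z + y) ` cball 0 (d / CARD('n))"
  \<comment> \<open>\<open>z + y\<close> is the barycentre of the \<open>n\<close> points \<open>z + n y\<^sub>k e\<^sub>k\<close>.\<close>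
  then obtain y where y: "norm y \<le> d / CARD('n)" "p = z + y"
    by (metis imageE mem_cball_0)
  let ?n = "real CARD('n)"
  have line: "z + t *\<^sub>R axis k 1 \<in> C" if "\<bar>t\<bar> \<le> d" for t k
  proof -
    \<comment> \<open>These weights solve a + b = 1 and (a - b) d = t, which places the target point
      on the segment between the two opposite vertices on axis \<open>k\<close>. They are
      nonnegative because |t| \<le> d.\<close>
    let ?a = "(d + t) / (2 * d)" and ?b = "(d - t) / (2 * d)"
    have ab: "?a + ?b = 1" "(?a - ?b) * d = t"
      using \<open>0 < d\<close> by (simp_all add: field_simps)
    have "?a *\<^sub>R (z + d *\<^sub>R axis k 1) + ?b *\<^sub>R (z - d *\<^sub>R axis k 1) \<in> C"
      using \<open>0 < d\<close> that by (intro convexD[OF \<open>convex C\<close> pos neg] ab) auto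
    also have "?a *\<^sub>R (z + d *\<^sub>R axis k 1) + ?b *\<^sub>R (z - d *\<^sub>R axis k 1)
        = (?a + ?b) *\<^sub>R z + ((?a - ?b) * d) *\<^sub>R axis k 1"
      by (simp only: algebra_simps scaleR_scaleR)
    finally show ?thesis using ab by simp
  qed
  \<comment> \<open>The radius d / n enters here: averaging n points forces each coordinate of
    \<open>y\<close> to be magnified by n, and the result must still lie between -d and d.\<close>
  have "\<bar>?n * y $ k\<bar> \<le> d" for k
  proof -
    have "\<bar>y $ k\<bar> \<le> d / ?n"
      using component_le_norm_cart y(1) by (rule order_trans)
    then show ?thesis by (simp add: abs_mult field_simps)
  qed
  then have "(\<Sum>k\<in>UNIV. (1 / ?n) *\<^sub>R (z + (?n * y $ k) *\<^sub>R axis k 1)) \<in> C"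
    by (intro convex_sum \<open>convex C\<close> line) auto
  also have "(\<Sum>k\<in>UNIV. (1 / ?n) *\<^sub>R (z + (?n * y $ k) *\<^sub>R axis k 1))
      = z + (\<Sum>k\<in>UNIV. y $ k *s axis k 1)"
    by (simp add: scaleR_right_distrib sum.distrib sum_constant_scaleR scalar_mult_eq_scaleR
        del: sum_constant)
  finally show "p \<in> C" by (simp add: basis_expansion y)
qed

lemma norm_signed_basis: "norm (signed_basis b j) = 1"
  by (simp add: signed_basis_def power_abs)

text \<open>Surjectivity of \<open>b\<close> supplies an index \<open>l\<close> for every axis
  \<open>k\<close>; then \<open>l\<close> (the case r = 0) carries the positive sign and n +
  \<open>l\<close> (the case r = 1) the negative one.\<close>

lemma signed_basis_cases:
  fixes b :: "nat \<Rightarrow> 'n::finite"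
  assumes "bij_betw b {1..CARD('n)} UNIV"
  obtains i j where "i \<in> {1..2 * CARD('n)}" "signed_basis b i = axis k 1"
    and "j \<in> {1..2 * CARD('n)}" "signed_basis b j = - axis k 1"
proof -
  obtain l where l: "l \<in> {1..CARD('n)}" "b l = k"
    using assms by (metis bij_betw_imp_surj_on UNIV_I imageE)
  show thesis
    using l signed_basis_eq[of l b 0] signed_basis_eq[of l b 1]
    by (intro that[of l "CARD('n) + l"]) auto
qed

theorem theorem6:
  fixes A :: "real^'n^'n" and B :: "real^'m^'n"
    and v :: "nat \<Rightarrow> real^'n" and w :: "nat \<Rightarrow> real^'m" and n_x n_u N :: nat
    and H_x :: "real^'n^'p" and q :: "real^'p"
    and H_u :: "real^'m^'r" and q_u :: "real^'r"
    and X :: "(real^'n) set" and U :: "(real^'m) set"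
    and b :: "nat \<Rightarrow> 'n"
  assumes "bij_betw b {1..CARD('n)} UNIV"
    and "X = convex hull (v ` {1..n_x})" and "X = {x. H_x *v x \<le> q}"
    and "U = convex hull (w ` {0..n_u})" and "U = {u. H_u *v u \<le> q_u}"
    and "N > CARD('n) + 1"
  shows "feasible_problem (trajectory_problem A B X U N b) \<longleftrightarrow>
         (\<exists>x. convex_feasible_trajectory A B X U N x)"
proof
  assume "feasible_problem (trajectory_problem A B X U N b)"
  then obtain x u lam d where
    "(x, u, lam, d) \<in> snd (trajectory_problem A B X U N b)"
    unfolding feasible_problem_def by (metis ex_in_conv prod_cases4)
  then have dyn: "\<And>i. i < N \<Longrightarrow> x (i + 1) = A *v x i + B *v u i \<and> x i \<in> X \<and> u i \<in> U"
    and comb: "\<And>j. j \<in> {1..2 * CARD('n)} \<Longrightarrow>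
      x N + d *\<^sub>R signed_basis b j = (\<Sum>i\<in>{0..<N}. lam i j *\<^sub>R x i) \<and>
      (\<Sum>i\<in>{0..<N}. lam i j) = 1 \<and> (\<forall>i\<in>{0..<N}. 0 \<le> lam i j)"
    and d: "0 < d"
    unfolding trajectory_problem_def by simp_all
  \<comment> \<open>Column \<open>j\<close> of \<open>lam\<close> serves as the weights over the
    states.\<close>
  have hull: "x N + d *\<^sub>R signed_basis b j \<in> convex hull (x ` {0..<N})"
    if "j \<in> {1..2 * CARD('n)}" for j
    unfolding convex_hull_finite_image_iff[OF finite_atLeastLessThan]
    using comb[OF that] by (intro exI[of _ "\<lambda>i. lam i j"]) auto
  have "(\<lambda>y. x N + y) ` cball 0 (d / CARD('n)) \<subseteq> convex hull (x ` {0..<N})"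
  proof (rule convex_contains_cball_of_axes[OF convex_convex_hull _ _ d])
    fix k
    obtain i j where "i \<in> {1..2 * CARD('n)}" "signed_basis b i = axis k 1"
      and "j \<in> {1..2 * CARD('n)}" "signed_basis b j = - axis k 1"
      using assms(1) by (rule signed_basis_cases)
    with hull[of i] hull[of j]
    show "x N + d *\<^sub>R axis k 1 \<in> convex hull (x ` {0..<N})"
      and "x N - d *\<^sub>R axis k 1 \<in> convex hull (x ` {0..<N})" by auto
  qed
  \<comment> \<open>A trajectory needs inputs in \<open>U\<close> at all times, also beyond the horizon.\<close>
  moreover have "w 0 \<in> U"
    using assms(4) by (simp add: hull_inc)
  then have "\<exists>u'. (\<forall>t. u' t \<in> U) \<and> (\<forall>t<N. x (t + 1) = A *v x t + B *v u' t)"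
    using dyn by (intro exI[of _ "\<lambda>t. if t < N then u t else w 0"]) auto
  ultimately show "\<exists>x. convex_feasible_trajectory A B X U N x"
    unfolding convex_feasible_trajectory_def using dyn d
    by (intro exI[of _ x] conjI exI[of _ "d / CARD('n)"]) auto
next
  assume "\<exists>x. convex_feasible_trajectory A B X U N x"
  then obtain x u d where x: "\<forall>t<N. x t \<in> X"
    and u: "\<forall>t. u t \<in> U" "\<forall>t<N. x (t + 1) = A *v x t + B *v u t"
    and d: "0 < d" "(\<lambda>y. x N + y) ` cball 0 d \<subseteq> convex hull (x ` {0..<N})"
    unfolding convex_feasible_trajectory_def by blast
  \<comment> \<open>Each signed basis vector has norm 1, so d times it lies on the boundary of the
    ball; the radius itself serves as the variable \<open>d\<close> of the problem.\<close>
  have "x N + d *\<^sub>R signed_basis b j \<in> convex hull (x ` {0..<N})" for j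
    using d by (intro subsetD[OF d(2)] imageI) (simp add: norm_signed_basis)
  then have "\<forall>j. \<exists>c. (\<forall>i\<in>{0..<N}. 0 \<le> c i) \<and> sum c {0..<N} = 1 \<and>
      x N + d *\<^sub>R signed_basis b j = (\<Sum>i\<in>{0..<N}. c i *\<^sub>R x i)"
    by (simp only: convex_hull_finite_image_iff[OF finite_atLeastLessThan] simp_thms)
  then obtain c where c: "\<And>j. (\<forall>i\<in>{0..<N}. 0 \<le> c j i) \<and> sum (c j) {0..<N} = 1 \<and>
      x N + d *\<^sub>R signed_basis b j = (\<Sum>i\<in>{0..<N}. c j i *\<^sub>R x i)"
    by metis
  \<comment> \<open>The weights were chosen separately for each \<open>j\<close>, so
    \<open>c\<close> takes \<open>j\<close> first and is transposed to match
    \<open>lam\<close>.\<close>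
  have "(x, u, \<lambda>i j. c j i, d) \<in> snd (trajectory_problem A B X U N b)"
    unfolding trajectory_problem_def using x u d(1) c by simp
  then show "feasible_problem (trajectory_problem A B X U N b)"
    unfolding feasible_problem_def by blast
qed

end
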